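(* (i) For all $x\in\mathbb C\setminus(-\infty,0]$, $$\Psi(x+1)=\ln x+\sum_{k=1}^\infty\Phi(-1,1,2^kx+1)=\ln x+\sum_{k=1}^\infty\sum_{j=1}^\infty\frac{(j-1)!}{2^j(2^kx+1)_j}.$$ (ii) For all $x\in\mathbb C\setminus(-\infty,0]$, $$\frac12\Psi\left(\frac x2+\frac12\right)-\frac12\Psi\left(\frac x2\right)=\sum_{n=1}^\infty\frac{\Gamma(n)}{2^n\,(x)_n},$$ and for $\Re x>0$, $$\frac12\Psi\left(\frac x2+\frac12\right)-\frac12\Psi\left(\frac x2\right)=\int_0^1\frac{t^{x-1}}{t+1}\,dt.$$ (iii) For all $x\in\mathbb C\setminus(-\infty,0]$, $$\Psi(x+1)=\ln x+\frac12\sum_{k=0}^\infty\left[\Psi\left(2^kx+1\right)-\Psi\left(2^kx+\tfrac12\right)\right].$$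
   Context: $\Psi(z)=\Gamma'(z)/\Gamma(z)$ is the digamma function; $\ln$ is the principal branch; $(x)_n=x(x+1)\cdots(x+n-1)=\Gamma(x+n)/\Gamma(x)$. $\Phi(z,1,x)$ is the Lerch transcendent, $\Phi(z,1,x)=\int_0^\infty\frac{e^{-xp}}{1-ze^{-p}}\,dp$ for $\Re x>0$, $z\in\mathbb C\setminus[1,\infty)$, extended by analytic continuation in $x$ to $\mathbb C\setminus\{0,-1,-2,\dots\}$. *)

theory Defs
  imports "HOL-Complex_Analysis.Complex_Analysis"
begin

lemma Digamma_eq_logderiv_Gamma:
  fixes z :: complex
  assumes "z \<notin> \<int>\<^sub>\<le>\<^sub>0"
  shows "Digamma z = deriv Gamma z / Gamma z"
  using DERIV_imp_deriv[OF has_field_derivative_Gamma[OF assms, of UNIV]] assms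
  by (simp add: Gamma_eq_zero_iff)

text \<open>
  The Lerch transcendent \<open>\<Phi>(z,1,x)\<close> as a function of \<open>x\<close>, for fixed \<open>z\<close> outside
  \<open>[1,\<infinity>)\<close>: a holomorphic function on the complement of the nonpositive integers given by
  the integral on the right half-plane. Lemma \<open>is_Lerch_Phi1_unique\<close> shows that its values
  there are uniquely determined; its values at the nonpositive integers are unspecified.
\<close>

definition is_Lerch_Phi1 :: "complex \<Rightarrow> (complex \<Rightarrow> complex) \<Rightarrow> bool" where
  "is_Lerch_Phi1 z f \<longleftrightarrow>
     f holomorphic_on (- \<int>\<^sub>\<le>\<^sub>0) \<and>
     (\<forall>x. Re x > 0 \<longrightarrow>
        ((\<lambda>p::real. exp (- x * of_real p) / (1 - z * exp (- of_real p))) has_integral f x) {0..})"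

definition Lerch_Phi1 :: "complex \<Rightarrow> complex \<Rightarrow> complex" where
  "Lerch_Phi1 z = (SOME f. is_Lerch_Phi1 z f)"

lemma is_Lerch_Phi1_unique:
  assumes f: "is_Lerch_Phi1 z f" and g: "is_Lerch_Phi1 z g" and x: "x \<notin> \<int>\<^sub>\<le>\<^sub>0"
  shows "f x = g x"
proof (rule analytic_continuation_open[where f = f and g = g and z = x and s = "{x. Re x > 0}" and s' = "- \<int>\<^sub>\<le>\<^sub>0"])
  show "open {x::complex. Re x > 0}"
    by (rule open_halfspace_Re_gt)
  show "open (- \<int>\<^sub>\<le>\<^sub>0 :: complex set)"
    by auto
  have "Re 1 > 0"
    by simp
  then show "{x::complex. Re x > 0} \<noteq> {}"
    by blast
  have "countable (\<int>\<^sub>\<le>\<^sub>0 :: complex set)"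
    by (rule countable_subset[OF nonpos_Ints_subset_Ints]) (simp add: Ints_def)
  then have "connected (UNIV - (\<int>\<^sub>\<le>\<^sub>0 :: complex set))"
    by (intro connected_open_diff_countable) auto
  then show "connected (- \<int>\<^sub>\<le>\<^sub>0 :: complex set)"
    by (simp add: Compl_eq_Diff_UNIV)
  show "{x::complex. Re x > 0} \<subseteq> - \<int>\<^sub>\<le>\<^sub>0"
    by (auto elim!: nonpos_Ints_cases)
  show "f holomorphic_on (- \<int>\<^sub>\<le>\<^sub>0)" "g holomorphic_on (- \<int>\<^sub>\<le>\<^sub>0)"
    using f g by (auto simp: is_Lerch_Phi1_def)
  show "f y = g y" if "y \<in> {x. Re x > 0}" for y
    using f g that has_integral_unique unfolding is_Lerch_Phi1_def by blast
  show "x \<in> - \<int>\<^sub>\<le>\<^sub>0"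
    using x by simp
qed

end

theory Submission
  imports Defs
begin

text \<open>
  Everything is expressed through one function, Nielsen's
  \<open>\<beta>(x) = (\<Psi>((x + 1)/2) - \<Psi>(x/2)) / 2 = \<Sum>k. (-1)\<^sup>k / (x + k)\<close>.

  \<^bold>\<open>Representations of \<beta>.\<close> The recurrence \<open>f(x) + f(x + 1) = 1/x\<close> determines a function
  at \<open>x\<close> as soon as \<open>f(x + n) \<rightarrow> 0\<close>: the difference of two solutions changes sign
  under \<open>x \<mapsto> x + 1\<close>, so its absolute value is constant along \<open>x + n\<close> and hence zero
  (lemma \<open>Nielsen_beta_eqI\<close>). That \<beta> itself tends to zero is read off from Gauss's limit
  \<open>\<Psi>(z + m) - ln m \<rightarrow> 0\<close>. The other candidates all satisfy the recurrence and are
  bounded by \<open>1 / Re x\<close> on the right half-plane: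

    \<^item> the integrals of \<open>t\<^bsup>x-1\<^esup> / (1 + t)\<close> over \<open>[0,1]\<close> and of
      \<open>e\<^bsup>-xp\<^esup> / (1 + e\<^bsup>-p\<^esup>)\<close> over \<open>[0,\<infinity>)\<close>, because adding the integrands at \<open>x\<close>
      and \<open>x + 1\<close> cancels the denominator;
    \<^item> the inverse factorial series, by a telescoping identity between its terms at \<open>x\<close>
      and \<open>x + 1\<close>.

  Since the argument runs along \<open>x + n\<close>, a bound on the right half-plane gives the series
  representation on all of \<open>\<complex> - {0, -1, -2, \<dots>}\<close>. The second integral shows that
  \<beta> is \<open>\<Phi>(-1, 1, x)\<close>, because \<beta> is holomorphic off the nonpositive integers.

  \<^bold>\<open>The dyadic series.\<close> By the duplication formula for \<Psi>, with \<open>E(z) = \<Psi>(z + 1) - ln z\<close>,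
  \<open>\<beta>(2z + 1) = E(z) - E(2z)\<close>,
  so the sum of \<open>\<beta>(2\<^bsup>k+1\<^esup>x + 1)\<close> over \<open>k \<ge> 0\<close> telescopes to \<open>E(x) - lim E(2\<^sup>kx)\<close>. The limit is zero by
  the bound \<open>|E(z)| \<le> 2 / (|z| + Re z)\<close> on the slit plane (lemma
  \<open>norm_Digamma_minus_Ln_le\<close>): its right-hand side is homogeneous of degree \<open>-1\<close>,
  hence decays along every ray other than the negative real axis.
\<close>

section \<open>Nielsen's beta function and its recurrence\<close>

definition Nielsen_beta :: "complex \<Rightarrow> complex" where
  "Nielsen_beta x = 1 / 2 * Digamma (x / 2 + 1 / 2) - 1 / 2 * Digamma (x / 2)"

lemma not_nonpos_Int_shift:
  fixes x :: complex
  assumes "x \<notin> \<int>\<^sub>\<le>\<^sub>0"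
  shows "x + of_nat n \<notin> \<int>\<^sub>\<le>\<^sub>0"
proof
  assume "x + of_nat n \<in> \<int>\<^sub>\<le>\<^sub>0"
  then have "x + of_nat n - of_nat n \<in> \<int>\<^sub>\<le>\<^sub>0"
    by (rule nonpos_Ints_diff_Nats) simp
  with assms show False by simp
qed

lemma half_not_nonpos_Int:
  fixes x :: complex
  assumes "x \<notin> \<int>\<^sub>\<le>\<^sub>0"
  shows "x / 2 \<notin> \<int>\<^sub>\<le>\<^sub>0" "x / 2 + 1 / 2 \<notin> \<int>\<^sub>\<le>\<^sub>0"
proof -
  have 1: "y / 2 \<notin> \<int>\<^sub>\<le>\<^sub>0" if "y \<notin> \<int>\<^sub>\<le>\<^sub>0" for y :: complex
  proof
    assume "y / 2 \<in> \<int>\<^sub>\<le>\<^sub>0"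
    then obtain n where "y / 2 = - of_nat n" by (elim nonpos_Ints_cases')
    then have "y = - of_nat (2 * n)" by (simp add: field_simps)
    with that show False by (metis minus_of_nat_in_nonpos_Ints)
  qed
  from 1[OF assms] show "x / 2 \<notin> \<int>\<^sub>\<le>\<^sub>0" .
  from 1[OF not_nonpos_Int_shift[OF assms, of 1]] show "x / 2 + 1 / 2 \<notin> \<int>\<^sub>\<le>\<^sub>0"
    by (simp add: add_divide_distrib)
qed

text \<open>
  By the recurrence for \<Psi>, this is Gauss's limit formula for \<open>\<Psi>(z)\<close> with the finite sum absorbed
  into the argument.
\<close>

lemma Digamma_shift_minus_ln_tendsto_0:
  fixes z :: complex
  assumes z: "z \<notin> \<int>\<^sub>\<le>\<^sub>0"
  shows "(\<lambda>m. Digamma (z + of_nat m) - of_real (ln (real m))) \<longlonglongrightarrow> 0"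
proof -
  have "z \<noteq> 0" using z by auto
  have neq: "z \<noteq> - of_nat k" for k
    using z by (metis minus_of_nat_in_nonpos_Ints)
  have eq: "Digamma (z + of_nat m) - of_real (ln (real m)) =
      Digamma z - (of_real (ln (real m)) - (\<Sum>n<m. inverse (z + of_nat n)))" for m
    using Polygamma_plus_of_nat[of m z 0] neq by (simp add: inverse_eq_divide)
  show ?thesis
    unfolding eq using tendsto_diff[OF tendsto_const Digamma_LIMSEQ[OF \<open>z \<noteq> 0\<close>], of "Digamma z"]
    by simp
qed

lemma Nielsen_beta_plus1:
  assumes "x \<noteq> 0"
  shows "Nielsen_beta x + Nielsen_beta (x + 1) = 1 / x"
proof -
  have "Digamma (x / 2 + 1) = Digamma (x / 2) + 2 / x"
    using Digamma_plus1[of "x / 2"] assms by simp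
  moreover have shifted: "(x + 1) / 2 + 1 / 2 = x / 2 + 1" "(x + 1) / 2 = x / 2 + 1 / 2"
    by (simp_all add: field_simps)
  ultimately show ?thesis
    unfolding Nielsen_beta_def shifted by (simp add: field_simps)
qed

text \<open>
  A step of two in \<open>x\<close> is a step of one in both digamma arguments, so the logarithms
  from the two limits cancel. Even steps are all that the uniqueness argument needs.
\<close>

lemma Nielsen_beta_tendsto_0:
  assumes x: "x \<notin> \<int>\<^sub>\<le>\<^sub>0"
  shows "(\<lambda>m. Nielsen_beta (x + of_nat (2 * m))) \<longlonglongrightarrow> 0"
proof -
  have eq: "Nielsen_beta (x + of_nat (2 * m)) =
      1 / 2 * (Digamma (x / 2 + 1 / 2 + of_nat m) - of_real (ln (real m)))
      - 1 / 2 * (Digamma (x / 2 + of_nat m) - of_real (ln (real m)))" for m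
    by (simp add: Nielsen_beta_def field_simps)
  have "(\<lambda>m. 1 / 2 * (Digamma (x / 2 + 1 / 2 + of_nat m) - of_real (ln (real m)))
      - 1 / 2 * (Digamma (x / 2 + of_nat m) - of_real (ln (real m)))) \<longlonglongrightarrow> 1 / 2 * 0 - 1 / 2 * 0"
    by (intro tendsto_diff tendsto_mult tendsto_const Digamma_shift_minus_ln_tendsto_0
        half_not_nonpos_Int x)
  then show ?thesis
    by (simp only: eq mult_zero_right diff_self)
qed

text \<open>
  The uniqueness principle. The difference of \<open>f\<close> and \<beta> is 2-periodic along \<open>x + n\<close> and tends
  to zero along even \<open>n\<close>. The sequence \<open>x + n\<close> may start in the left half-plane; it enters the
  right half-plane, where the bound applies, after finitely many steps.
\<close>

lemma Nielsen_beta_eqI: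
  assumes x: "x \<notin> \<int>\<^sub>\<le>\<^sub>0"
    and rec: "\<And>n. f (x + of_nat n) + f (x + of_nat n + 1) = 1 / (x + of_nat n)"
    and bound: "\<And>n. Re (x + of_nat n) > 0 \<Longrightarrow> norm (f (x + of_nat n)) \<le> 1 / Re (x + of_nat n)"
  shows "f x = Nielsen_beta x"
proof -
  define d where "d n = f (x + of_nat n) - Nielsen_beta (x + of_nat n)" for n
  have d_Suc: "d (Suc n) = - d n" for n
  proof -
    have "x + of_nat n \<noteq> 0"
      using not_nonpos_Int_shift[OF x, of n] by auto
    from Nielsen_beta_plus1[OF this] rec[of n] show ?thesis
      by (simp add: d_def add_ac) (simp add: algebra_simps eq_neg_iff_add_eq_0)
  qed
  have d_even: "d (2 * m) = d 0" for m
    by (induction m) (simp_all add: d_Suc)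
  have "(\<lambda>n. f (x + of_nat n)) \<longlonglongrightarrow> 0"
  proof (rule Lim_null_comparison)
    have "eventually (\<lambda>n. real n > - Re x) sequentially"
      by real_asymp
    then show "eventually (\<lambda>n. norm (f (x + of_nat n)) \<le> 1 / Re (x + of_nat n)) sequentially"
      by eventually_elim (rule bound, simp)
    show "(\<lambda>n. 1 / Re (x + of_nat n)) \<longlonglongrightarrow> 0"
      by simp real_asymp
  qed
  then have "(\<lambda>m. f (x + of_nat (2 * m))) \<longlonglongrightarrow> 0"
    by (rule filterlim_compose) (simp add: filterlim_subseq strict_mono_def)
  from tendsto_diff[OF this Nielsen_beta_tendsto_0[OF x]]
  have "(\<lambda>m. d (2 * m)) \<longlonglongrightarrow> 0"
    by (simp add: d_def)
  then have "d 0 = 0"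
    by (simp add: d_even LIMSEQ_const_iff)
  then show ?thesis by (simp add: d_def)
qed

section \<open>Integral representations\<close>

text \<open>
  For a kernel \<open>e x\<close> whose integral is \<open>1/x\<close> and which is multiplied by \<open>r\<close> under
  \<open>x \<mapsto> x + 1\<close>, the integrands \<open>e x / (1 + r)\<close> at \<open>x\<close> and \<open>x + 1\<close> add up to \<open>e x\<close>, which is
  the recurrence for the integrals. As \<open>1 + r \<ge> 1\<close>, the integral of \<open>|e x|\<close> bounds them by
  \<open>1 / Re x\<close>. The Mellin kernel \<open>t\<^bsup>x-1\<^esup>\<close> on \<open>[0,1]\<close> and the Laplace kernel \<open>e\<^bsup>-xp\<^esup>\<close> on
  \<open>[0,\<infinity>)\<close> are both instances.
\<close>

lemma Nielsen_beta_has_integralI: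
  fixes e :: "complex \<Rightarrow> real \<Rightarrow> complex" and r :: "real \<Rightarrow> real"
  assumes S: "S \<in> sets lebesgue"
    and e: "\<And>x. Re x > 0 \<Longrightarrow> (e x has_integral 1 / x) S"
    and norm_e: "\<And>x. Re x > 0 \<Longrightarrow> ((\<lambda>t. norm (e x t)) has_integral 1 / Re x) S"
    and step: "\<And>x t. Re x > 0 \<Longrightarrow> t \<in> S \<Longrightarrow> e (x + 1) t = e x t * of_real (r t)"
    and r: "\<And>t. t \<in> S \<Longrightarrow> r t \<ge> 0"
    and meas: "r \<in> borel_measurable (lebesgue_on S)"
    and x: "Re x > 0"
  shows "((\<lambda>t. e x t / (1 + of_real (r t))) has_integral Nielsen_beta x) S"
proof -
  define f where "f y = (\<lambda>t. e y t / (1 + of_real (r t)))" for y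
  have norm_f: "norm (f y t) \<le> norm (e y t)" if "t \<in> S" for y t
  proof -
    have "norm (1 + complex_of_real (r t)) = 1 + r t"
      using r[OF that] by (metis norm_of_real of_real_1 of_real_add abs_of_nonneg add_nonneg_nonneg zero_le_one)
    then show ?thesis
      using r[OF that] by (simp add: f_def norm_divide divide_le_eq mult_le_cancel_left1 mult_left_le)
  qed
  have f_meas: "f y \<in> borel_measurable (lebesgue_on S)" if "Re y > 0" for y
    unfolding f_def using meas integrable_imp_measurable[OF has_integral_integrable[OF e[OF that]]]
    by measurable
  have f_int: "f y integrable_on S" if "Re y > 0" for y
    using measurable_bounded_by_integrable_imp_absolutely_integrable
      [OF f_meas[OF that] S has_integral_integrable[OF norm_e[OF that]]] norm_f
    by (simp add: set_lebesgue_integral_eq_integral(1))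
  have f_bound: "norm (integral S (f y)) \<le> 1 / Re y" if "Re y > 0" for y
    using integral_norm_bound_integral'[OF norm_f f_meas[OF that] S norm_e[OF that]] .
  have f_rec: "integral S (f y) + integral S (f (y + 1)) = 1 / y" if y: "Re y > 0" for y
  proof -
    have eq: "f y t + f (y + 1) t = e y t" if "t \<in> S" for t
    proof -
      have "1 + complex_of_real (r t) \<noteq> 0"
        using r[OF that] by (metis add_nonneg_eq_0_iff of_real_1 of_real_add of_real_eq_0_iff zero_le_one zero_neq_one)
      then show ?thesis
        by (simp add: f_def step[OF y that] divide_simps) (simp add: algebra_simps)
    qed
    have "((\<lambda>t. f y t + f (y + 1) t) has_integral integral S (f y) + integral S (f (y + 1))) S"
      by (intro has_integral_add integrable_integral f_int) (use y in auto)
    then have "(e y has_integral integral S (f y) + integral S (f (y + 1))) S"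
      by (rule has_integral_eq[rotated]) (use eq in auto)
    with e[OF y] show ?thesis
      using has_integral_unique by blast
  qed
  have "integral S (f x) = Nielsen_beta x"
  proof (rule Nielsen_beta_eqI)
    show "x \<notin> \<int>\<^sub>\<le>\<^sub>0"
      using x by (auto elim!: nonpos_Ints_cases)
    show "integral S (f (x + of_nat n)) + integral S (f (x + of_nat n + 1)) = 1 / (x + of_nat n)" for n
      by (rule f_rec) (use x in auto)
  qed (rule f_bound)
  with integrable_integral[OF f_int[OF x]] show ?thesis
    by (simp add: f_def)
qed


text \<open>Dominated convergence of the integrals over \<open>[0,n]\<close>, with dominating function \<open>e\<^bsup>-p Re x\<^esup>\<close>.\<close>

lemma has_integral_exp_neg_complex:
  fixes x :: complex
  assumes x: "Re x > 0"
  shows "((\<lambda>p::real. exp (- x * of_real p)) has_integral 1 / x) {0..}"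
proof -
  have "x \<noteq> 0" using x by auto
  define f where "f n = (\<lambda>p::real. if p \<in> {0..real n} then exp (- x * of_real p) else 0)" for n
  have f_int: "(f n has_integral (1 - exp (- x * of_nat n)) / x) {0..}" for n
  proof -
    have "((\<lambda>p::real. exp (- x * of_real p)) has_integral
        (- exp (- x * of_real (real n)) / x - - exp (- x * of_real 0) / x)) {0..real n}"
      by (intro fundamental_theorem_of_calculus)
         (use \<open>x \<noteq> 0\<close> in \<open>auto intro!: derivative_eq_intros
            has_vector_derivative_real_field simp: field_simps\<close>)
    then have "((\<lambda>p::real. exp (- x * of_real p)) has_integral (1 - exp (- x * of_nat n)) / x) {0..real n}"
      by (simp add: diff_divide_distrib)
    then show ?thesis
      unfolding f_def by (subst has_integral_restrict) auto
  qed
  have f_integrable: "f n integrable_on {0..}" for n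
    using f_int by (rule has_integral_integrable)
  have dominating: "(\<lambda>p. exp (- Re x * p)) integrable_on {0..}"
    using x by (rule integrable_on_exp_minus_to_infinity)
  have f_bound: "norm (f n p) \<le> exp (- Re x * p)" for n p
    by (simp add: f_def)
  have f_lim: "(\<lambda>n. f n p) \<longlonglongrightarrow> exp (- x * of_real p)" if "p \<in> {0..}" for p
  proof (rule tendsto_eventually)
    show "eventually (\<lambda>n. f n p = exp (- x * of_real p)) sequentially"
      using eventually_ge_at_top[of "nat \<lceil>p\<rceil>"]
      by eventually_elim (use that in \<open>auto simp: f_def\<close>)
  qed
  note dominated_convergence[OF f_integrable dominating f_bound f_lim]
  moreover have "(\<lambda>n. integral {0..} (f n)) \<longlonglongrightarrow> 1 / x"
  proof -
    have "(\<lambda>n. exp (- x * of_nat n)) \<longlonglongrightarrow> 0"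
    proof (rule tendsto_norm_zero_cancel)
      show "(\<lambda>n. norm (exp (- x * of_nat n))) \<longlonglongrightarrow> 0"
        using x by simp real_asymp
    qed
    then have "(\<lambda>n. (1 - exp (- x * of_nat n)) / x) \<longlonglongrightarrow> (1 - 0) / x"
      by (intro tendsto_intros) (use \<open>x \<noteq> 0\<close> in auto)
    then show ?thesis
      by (simp add: integral_unique[OF f_int])
  qed
  ultimately show ?thesis
    by (metis LIMSEQ_unique integrable_integral)
qed

lemma has_integral_powr_complex:
  fixes x :: complex
  assumes x: "Re x > 0"
  shows "((\<lambda>t::real. of_real t powr (x - 1)) has_integral 1 / x) {0..1}"
proof -
  have "x \<noteq> 0" using x by auto
  have "((\<lambda>t::real. of_real t powr (x - 1)) has_integral
      (of_real 1 powr x / x - of_real 0 powr x / x)) {0..1}"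
  proof (rule fundamental_theorem_of_calculus_interior)
    show "continuous_on {0..1} (\<lambda>t::real. of_real t powr x / x)"
      by (intro continuous_intros) (use x in auto)
    show "((\<lambda>t::real. of_real t powr x / x) has_vector_derivative of_real t powr (x - 1)) (at t)"
      if "t \<in> {0<..<1}" for t
    proof (rule has_vector_derivative_real_field)
      have "complex_of_real t \<notin> \<real>\<^sub>\<le>\<^sub>0"
        using that by simp
      from DERIV_cdivide[OF has_field_derivative_powr[OF this, of x], of x] \<open>x \<noteq> 0\<close>
      show "((\<lambda>z. z powr x / x) has_field_derivative of_real t powr (x - 1)) (at (of_real t))"
        by simp
    qed
  qed simp
  then show ?thesis
    by simp
qed

lemma Nielsen_beta_integral_powr:
  assumes "Re x > 0"
  shows "((\<lambda>t::real. of_real t powr (x - 1) / (of_real t + 1)) has_integral Nielsen_beta x) {0..1}"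
proof -
  have "((\<lambda>t::real. of_real t powr (x - 1) / (1 + of_real t)) has_integral Nielsen_beta x) {0..1}"
  proof (rule Nielsen_beta_has_integralI)
    show "((\<lambda>t. norm (of_real t powr (y - 1))) has_integral 1 / Re y) {0..1}" if "Re y > 0" for y
      using has_integral_powr_from_0[of "Re y - 1" 1] that
      by (rule_tac has_integral_eq[rotated]) (auto simp: norm_powr_real_powr)
    show "of_real t powr (y + 1 - 1) = of_real t powr (y - 1) * of_real t"
      if "Re y > 0" "t \<in> {0..1}" for y :: complex and t :: real
      using that by (cases "t = 0") (auto simp: powr_diff)
    show "(\<lambda>t::real. t) \<in> borel_measurable (lebesgue_on {0..1})"
      by (intro continuous_imp_measurable_on_sets_lebesgue continuous_intros) auto
  qed (use assms in \<open>auto intro: has_integral_powr_complex\<close>)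
  then show ?thesis
    by (simp add: add.commute)
qed

lemma Nielsen_beta_integral_exp:
  assumes "Re x > 0"
  shows "((\<lambda>p::real. exp (- x * of_real p) / (1 + exp (- of_real p))) has_integral Nielsen_beta x) {0..}"
proof -
  have "((\<lambda>p::real. exp (- x * of_real p) / (1 + of_real (exp (- p)))) has_integral Nielsen_beta x) {0..}"
  proof (rule Nielsen_beta_has_integralI)
    show "((\<lambda>p. norm (exp (- y * of_real p))) has_integral 1 / Re y) {0..}" if "Re y > 0" for y
      using has_integral_exp_minus_to_infinity[OF that, of 0] by simp
    show "exp (- (y + 1) * of_real p) = exp (- y * of_real p) * of_real (exp (- p))"
      for y :: complex and p :: real
      by (simp add: exp_of_real[symmetric] exp_add[symmetric] algebra_simps)
    show "(\<lambda>p::real. exp (- p)) \<in> borel_measurable (lebesgue_on {0..})"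
      by (intro continuous_imp_measurable_on_sets_lebesgue continuous_intros) auto
    show "((\<lambda>p::real. exp (- y * of_real p)) has_integral 1 / y) {0..}" if "Re y > 0" for y
      using that by (rule has_integral_exp_neg_complex)
  qed (use assms in auto)
  then show ?thesis
    by (simp add: exp_of_real[symmetric])
qed

text \<open>
  \<beta> itself meets both requirements on the Lerch transcendent: holomorphy and the Laplace
  integral. Hence the choice operator has a witness, and uniqueness of the continuation identifies
  the chosen function with it.
\<close>

lemma Lerch_Phi1_minus_1:
  assumes x: "x \<notin> \<int>\<^sub>\<le>\<^sub>0"
  shows "Lerch_Phi1 (-1) x = Nielsen_beta x"
proof -
  have beta: "is_Lerch_Phi1 (-1) Nielsen_beta"
    unfolding is_Lerch_Phi1_def
  proof (intro conjI allI impI)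
    have "(\<lambda>y::complex. Digamma (y / 2 + 1 / 2)) analytic_on (- \<int>\<^sub>\<le>\<^sub>0)"
      by (rule analytic_on_Polygamma')
         (auto intro!: analytic_on_add analytic_on_divide analytic_on_ident analytic_on_const half_not_nonpos_Int)
    moreover have "(\<lambda>y::complex. Digamma (y / 2)) analytic_on (- \<int>\<^sub>\<le>\<^sub>0)"
      by (rule analytic_on_Polygamma')
         (auto intro!: analytic_on_divide analytic_on_ident analytic_on_const half_not_nonpos_Int)
    ultimately have "Nielsen_beta analytic_on (- \<int>\<^sub>\<le>\<^sub>0)"
      unfolding Nielsen_beta_def[abs_def] by (intro analytic_on_diff analytic_on_mult analytic_on_const)
    then show "Nielsen_beta holomorphic_on (- \<int>\<^sub>\<le>\<^sub>0)"
      by (rule analytic_imp_holomorphic)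
    show "((\<lambda>p::real. exp (- y * of_real p) / (1 - (- 1) * exp (- of_real p))) has_integral
        Nielsen_beta y) {0..}" if "Re y > 0" for y
      using Nielsen_beta_integral_exp[OF that] by simp
  qed
  have "is_Lerch_Phi1 (-1) (Lerch_Phi1 (-1))"
    unfolding Lerch_Phi1_def by (rule someI[of "is_Lerch_Phi1 (-1)", OF beta])
  then show ?thesis
    by (rule is_Lerch_Phi1_unique[OF _ beta x])
qed

section \<open>The inverse factorial series\<close>

definition inverse_factorial_term :: "complex \<Rightarrow> nat \<Rightarrow> complex" where
  "inverse_factorial_term x n = fact n / (2 ^ Suc n * pochhammer x (Suc n))"

lemma inverse_factorial_term_Suc:
  "inverse_factorial_term x (Suc n) =
     inverse_factorial_term x n * (of_nat (Suc n) / (2 * (x + of_nat (Suc n))))"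
  unfolding inverse_factorial_term_def times_divide_times_eq
  by (simp add: pochhammer_Suc[of x "Suc n"] mult_ac del: of_nat_Suc)

text \<open>
  The ratio of consecutive terms tends to \<open>1/2\<close>; once \<open>n + 1 \<ge> 3 |x|\<close> it is at most \<open>3/4\<close>.
\<close>

lemma summable_inverse_factorial_term: "summable (inverse_factorial_term x)"
proof (rule summable_ratio_test)
  show "3 / 4 < (1::real)" by simp
  show "norm (inverse_factorial_term x (Suc n)) \<le> 3 / 4 * norm (inverse_factorial_term x n)"
    if n: "n \<ge> nat \<lceil>3 * norm x\<rceil>" for n
  proof -
    have "3 * norm x \<le> real (Suc n)" using n by linarith
    moreover have "real (Suc n) \<le> norm (x + of_nat (Suc n)) + norm x"
      using norm_triangle_ineq4[of "x + of_nat (Suc n)" x] by (metis add_diff_cancel_left' norm_of_nat)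
    moreover have "2 * s \<le> 3 * a" if "3 * b \<le> s" "s \<le> a + b" for a b s :: real
      using that by linarith
    ultimately have *: "2 * real (Suc n) \<le> 3 * norm (x + of_nat (Suc n))"
      by blast
    then have "norm (x + of_nat (Suc n)) > 0"
      by (smt (verit) of_nat_0_less_iff zero_less_Suc)
    with * have "norm (of_nat (Suc n) / (2 * (x + of_nat (Suc n)))) \<le> 3 / 4"
      by (simp only: norm_divide norm_mult norm_of_nat norm_numeral) (simp add: divide_le_eq)
    then show ?thesis
      unfolding inverse_factorial_term_Suc norm_mult
      by (metis mult.commute mult_left_mono norm_ge_zero)
  qed
qed

text \<open>
  On the right half-plane \<open>|x + n| \<ge> n\<close>, so each term ratio is at most \<open>1/2\<close>. The geometric bound
  adds up to exactly the \<open>1 / Re x\<close> required by the uniqueness principle.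
\<close>

lemma norm_inverse_factorial_term_le:
  assumes "Re x > 0"
  shows "norm (inverse_factorial_term x n) \<le> (1 / 2) ^ Suc n / Re x"
proof (induction n)
  case 0
  have "Re x \<le> norm x" by (rule complex_Re_le_cmod)
  with assms show ?case
    by (simp add: inverse_factorial_term_def norm_divide norm_mult frac_le)
next
  case (Suc n)
  have "real (Suc n) \<le> norm (x + of_nat (Suc n))"
    using complex_Re_le_cmod[of "x + of_nat (Suc n)"] assms by simp
  then have "norm (of_nat (Suc n) / (2 * (x + of_nat (Suc n)))) \<le> 1 / 2"
    by (simp only: norm_divide norm_mult norm_of_nat norm_numeral) (simp add: divide_le_eq)
  then have "norm (inverse_factorial_term x (Suc n)) \<le> (1 / 2) ^ Suc n / Re x * (1 / 2)"
    unfolding inverse_factorial_term_Suc norm_mult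
    by (intro mult_mono Suc.IH) (use assms in auto)
  then show ?case by simp
qed

text \<open>
  With \<open>a n = n! / (x)\<^bsub>n+1\<^esub>\<close>, the corresponding quotient at \<open>x + 1\<close> is \<open>a n - a (n + 1)\<close>. Weighting by
  \<open>2\<^bsup>-(n+1)\<^esup>\<close> gives \<open>S(x + 1) = S(x) - 2 (S(x) - a 0 / 2)\<close> for the sums, with \<open>a 0 = 1/x\<close>.
\<close>

lemma suminf_inverse_factorial_term_plus1:
  assumes x: "x \<notin> \<int>\<^sub>\<le>\<^sub>0"
  shows "suminf (inverse_factorial_term x) + suminf (inverse_factorial_term (x + 1)) = 1 / x"
proof -
  note summ = summable_inverse_factorial_term
  have step: "inverse_factorial_term (x + 1) n =
      inverse_factorial_term x n - 2 * inverse_factorial_term x (Suc n)" for n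
  proof -
    have nz: "x + of_nat k \<noteq> 0" for k
      using not_nonpos_Int_shift[OF x, of k] by auto
    have "pochhammer x (Suc n) \<noteq> 0"
      using nz by (auto simp: pochhammer_eq_0_iff eq_neg_iff_add_eq_0)
    moreover have "x * pochhammer (x + 1) (Suc n) = pochhammer x (Suc n) * (x + of_nat (Suc n))"
      using pochhammer_rec[of x "Suc n"] pochhammer_Suc[of x "Suc n"] by simp
    moreover have "x \<noteq> 0" "x + of_nat (Suc n) \<noteq> 0" using nz[of 0] nz[of "Suc n"] by auto
    moreover from calculation have "pochhammer (x + 1) (Suc n) \<noteq> 0"
      by (metis mult_eq_0_iff)
    ultimately have "inverse_factorial_term (x + 1) n =
        inverse_factorial_term x n * (x / (x + of_nat (Suc n)))"
      unfolding inverse_factorial_term_def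
      by (simp add: divide_simps mult_ac del: of_nat_Suc)
    also have "x / (x + of_nat (Suc n)) = 1 - 2 * (of_nat (Suc n) / (2 * (x + of_nat (Suc n))))"
    proof -
      have "2 * (a / (2 * b)) = a / b" for a b :: complex
        by simp
      moreover have "x / (x + of_nat (Suc n)) = 1 - of_nat (Suc n) / (x + of_nat (Suc n))"
        using \<open>x + of_nat (Suc n) \<noteq> 0\<close> by (simp add: field_simps del: of_nat_Suc)
      ultimately show ?thesis
        by (simp only:)
    qed
    finally show ?thesis
      by (simp add: inverse_factorial_term_Suc algebra_simps)
  qed
  have "suminf (inverse_factorial_term (x + 1)) =
      suminf (inverse_factorial_term x) - 2 * (\<Sum>n. inverse_factorial_term x (Suc n))"
  proof -
    have "summable (\<lambda>n. inverse_factorial_term x (Suc n))"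
      using summ[of x] by (simp add: summable_Suc_iff)
    from suminf_diff[OF summ[of x] summable_mult[OF this, of 2]] suminf_mult[OF this, of 2]
    show ?thesis
      by (simp only: step[abs_def])
  qed
  also have "(\<Sum>n. inverse_factorial_term x (Suc n)) =
      suminf (inverse_factorial_term x) - inverse_factorial_term x 0"
    using suminf_split_head[OF summ] .
  also have "inverse_factorial_term x 0 = 1 / x / 2"
    by (simp add: inverse_factorial_term_def)
  finally show ?thesis
    by simp
qed

lemma Nielsen_beta_series:
  assumes x: "x \<notin> \<int>\<^sub>\<le>\<^sub>0"
  shows "inverse_factorial_term x sums Nielsen_beta x"
proof -
  have "suminf (inverse_factorial_term x) = Nielsen_beta x"
  proof (rule Nielsen_beta_eqI[OF x])
    show "suminf (inverse_factorial_term (x + of_nat n)) +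
        suminf (inverse_factorial_term (x + of_nat n + 1)) = 1 / (x + of_nat n)" for n
      by (rule suminf_inverse_factorial_term_plus1[OF not_nonpos_Int_shift[OF x]])
    show "norm (suminf (inverse_factorial_term (x + of_nat n))) \<le> 1 / Re (x + of_nat n)"
      if "Re (x + of_nat n) > 0" for n
    proof -
      have sums: "(\<lambda>j. (1 / 2) ^ Suc j / Re (x + of_nat n)) sums (1 / Re (x + of_nat n))"
        using sums_divide[OF power_half_series] .
      show ?thesis
        unfolding sums_unique[OF sums]
        by (rule norm_suminf_le[OF norm_inverse_factorial_term_le[OF that] sums_summable[OF sums]])
    qed
  qed
  with summable_inverse_factorial_term[of x] show ?thesis
    by (metis summable_sums)
qed

section \<open>Duplication and asymptotics of the digamma function\<close>

text \<open>
  In the limit formula for \<open>\<Psi>(2z)\<close> taken along even cut-offs \<open>2m\<close>, the even and odd summands form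
  the partial sums for \<open>z\<close> and \<open>z + 1/2\<close>; the term \<open>ln 2\<close> comes from \<open>ln (2m) = ln 2 + ln m\<close>.
\<close>

lemma Digamma_duplication:
  fixes z :: complex
  assumes z: "z \<noteq> 0" "z \<noteq> - 1 / 2"
  shows "Digamma (2 * z) = 1 / 2 * Digamma z + 1 / 2 * Digamma (z + 1 / 2) + of_real (ln 2)"
proof -
  define a where "a w m = complex_of_real (ln (real m)) - (\<Sum>n<m. inverse (w + of_nat n))" for w m
  have a_lim: "a w \<longlonglongrightarrow> Digamma w" if "w \<noteq> 0" for w
    using Digamma_LIMSEQ[OF that] by (simp add: a_def[abs_def])
  have split: "(\<Sum>n<2 * m. inverse (2 * z + of_nat n)) =
      1 / 2 * (\<Sum>n<m. inverse (z + of_nat n)) + 1 / 2 * (\<Sum>n<m. inverse (z + 1 / 2 + of_nat n))" for m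
  proof (induction m)
    case (Suc m)
    have "inverse (2 * z + of_nat (2 * m)) = 1 / 2 * inverse (z + of_nat m)"
      "inverse (2 * z + of_nat (Suc (2 * m))) = 1 / 2 * inverse (z + 1 / 2 + of_nat m)"
      by (simp_all add: divide_simps) (simp_all add: algebra_simps)?
    with Suc show ?case
      by (simp only: mult_Suc_right sum.lessThan_Suc add_2_eq_Suc) (simp add: distrib_left)
  qed simp
  have "eventually (\<lambda>m. a (2 * z) (2 * m) = 1 / 2 * a z m + 1 / 2 * a (z + 1 / 2) m + of_real (ln 2)) sequentially"
    using eventually_gt_at_top[of 0]
    by eventually_elim (simp only: a_def split, simp add: ln_mult algebra_simps)
  moreover have "(\<lambda>m. 1 / 2 * a z m + 1 / 2 * a (z + 1 / 2) m + of_real (ln 2))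
      \<longlonglongrightarrow> 1 / 2 * Digamma z + 1 / 2 * Digamma (z + 1 / 2) + of_real (ln 2)"
    by (intro tendsto_intros a_lim) (use z in \<open>auto simp: add_eq_0_iff2\<close>)
  ultimately have "(\<lambda>m. a (2 * z) (2 * m))
      \<longlonglongrightarrow> 1 / 2 * Digamma z + 1 / 2 * Digamma (z + 1 / 2) + of_real (ln 2)"
    by (simp add: tendsto_cong)
  moreover have "(\<lambda>m. a (2 * z) (2 * m)) \<longlonglongrightarrow> Digamma (2 * z)"
    by (rule filterlim_compose[OF a_lim]) (use z in \<open>simp_all add: filterlim_subseq strict_mono_def\<close>)
  ultimately show ?thesis
    using LIMSEQ_unique by blast
qed

text \<open>
  A quantitative form of the statement that moving right from \<open>z\<close> cannot lead close to the origin
  unless \<open>z\<close> lies near the negative real axis. The two sides differ by \<open>(|z| - Re z) (|z| - t)\<^sup>2\<close>.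
\<close>

lemma sector_norm_add_ge:
  fixes z :: complex
  assumes t: "t \<ge> 0"
  shows "(norm z + t)\<^sup>2 * (norm z + Re z) \<le> 2 * norm z * (norm (z + of_real t))\<^sup>2"
proof -
  have "(norm (z + of_real t))\<^sup>2 = (norm z)\<^sup>2 + 2 * t * Re z + t\<^sup>2"
    by (simp add: cmod_power2) (simp add: power2_eq_square algebra_simps)
  then have "2 * norm z * (norm (z + of_real t))\<^sup>2 - (norm z + t)\<^sup>2 * (norm z + Re z) =
      (norm z - Re z) * (norm z - t)\<^sup>2"
    by (simp add: power2_eq_square algebra_simps)
  moreover have "(norm z - Re z) * (norm z - t)\<^sup>2 \<ge> 0"
    by (simp add: complex_Re_le_cmod)
  ultimately show ?thesis by linarith
qed

text \<open>
  Write \<open>\<Psi>(z + 1) - ln z\<close> as the sum over \<open>k \<ge> 0\<close> of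
  \<open>u k = ln (z + k + 1) - ln (z + k) - 1 / (z + k + 1)\<close>. By the mean value inequality and the
  sector estimate, \<open>|u k|\<close> is at most \<open>C / ((|z| + k) (|z| + k + 1))\<close> with
  \<open>C = 2 |z| / (|z| + Re z)\<close>, and these bounds telescope to \<open>C / |z|\<close>.
\<close>

lemma norm_Digamma_minus_Ln_le:
  fixes z :: complex
  assumes z: "z \<notin> \<real>\<^sub>\<le>\<^sub>0"
  shows "norm (Digamma (z + 1) - Ln z) \<le> 2 / (norm z + Re z)"
proof -
  have shift: "z + of_real t \<notin> \<real>\<^sub>\<le>\<^sub>0" if "t \<ge> 0" for t
    using z that by (auto simp: complex_nonpos_Reals_iff)
  have "norm z > 0" using z by auto
  have pos: "norm z + Re z > 0"
  proof (rule ccontr)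
    assume "\<not> ?thesis"
    then have "Re z = - norm z"
      using abs_Re_le_cmod[of z] by linarith
    then have "Re z \<le> 0" "Im z = 0"
      using cmod_power2[of z] by auto
    with z show False by (simp add: complex_nonpos_Reals_iff)
  qed
  define C where "C = 2 * norm z / (norm z + Re z)"
  have "C > 0" using pos \<open>norm z > 0\<close> by (simp add: C_def)
  have C: "norm z + t \<le> sqrt C * norm (z + of_real t)" if "t \<ge> 0" for t
  proof (rule power2_le_imp_le)
    show "(norm z + t)\<^sup>2 \<le> (sqrt C * norm (z + of_real t))\<^sup>2"
      using sector_norm_add_ge[OF that, of z] pos \<open>C > 0\<close>
      by (simp add: C_def power_mult_distrib field_simps)
  qed (use \<open>C > 0\<close> in auto)
  have inv_bound: "norm (1 / (z + of_real s) * (1 / (z + of_real t))) \<le> C / ((norm z + s) * (norm z + t))"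
    if "s \<ge> 0" "t \<ge> 0" for s t
  proof -
    have "(norm z + s) * (norm z + t) \<le>
        (sqrt C * norm (z + of_real s)) * (sqrt C * norm (z + of_real t))"
      by (intro mult_mono C that) (use that \<open>C > 0\<close> in auto)
    also have "\<dots> = C * (norm (z + of_real s) * norm (z + of_real t))"
      using \<open>C > 0\<close> by simp
    finally have *: "(norm z + s) * (norm z + t) \<le> C * (norm (z + of_real s) * norm (z + of_real t))" .
    have "norm (z + of_real s) > 0" "norm (z + of_real t) > 0"
      using shift[OF that(1)] shift[OF that(2)] by auto
    moreover have "(norm z + s) * (norm z + t) > 0"
      using that \<open>norm z > 0\<close> by (simp add: add_pos_nonneg)
    ultimately show ?thesis
      using * by (simp add: norm_mult norm_divide divide_simps)
  qed
  define u where "u k = Ln (z + of_nat (Suc k)) - Ln (z + of_nat k) - 1 / (z + of_nat (Suc k))" for k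
  have u_bound: "norm (u k) \<le> C * (1 / (norm z + k) - 1 / (norm z + Suc k))" for k
  proof -
    \<comment> \<open>\<open>u k\<close> is the increment over \<open>[0,1]\<close> of a function whose derivative at \<open>s\<close> is
      \<open>1 / (z + k + s) - 1 / (z + k + 1) = (1 - s) / ((z + k + s) (z + k + 1))\<close>.\<close>
    define h where "h \<xi> = Ln (z + of_nat k + \<xi>) - \<xi> / (z + of_nat (Suc k))" for \<xi>
    have "norm (h 1 - h 0) \<le> C / ((norm z + k) * (norm z + Suc k)) * norm (1 - 0 :: complex)"
    proof (rule field_differentiable_bound)
      fix \<xi> :: complex assume "\<xi> \<in> closed_segment 0 1"
      then obtain s where s: "0 \<le> s" "s \<le> 1" "\<xi> = of_real s"
        by (auto simp: in_segment scaleR_conv_of_real)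
      have notin: "z + of_nat k + \<xi> \<notin> \<real>\<^sub>\<le>\<^sub>0" "z + of_nat (Suc k) \<notin> \<real>\<^sub>\<le>\<^sub>0"
        using shift[of "k + s"] shift[of "Suc k"] s by (auto simp: add_ac)
      show "(h has_field_derivative 1 / (z + of_nat k + \<xi>) - 1 / (z + of_nat (Suc k)))
          (at \<xi> within closed_segment 0 1)"
        unfolding h_def[abs_def] using notin
        by (auto intro!: derivative_eq_intros simp: inverse_eq_divide)
      have "1 / (z + of_nat k + \<xi>) - 1 / (z + of_nat (Suc k)) =
          (1 - of_real s) * (1 / (z + of_real (k + s)) * (1 / (z + of_real (Suc k))))"
        using notin s by (auto simp: divide_simps) (auto simp: algebra_simps)
      also have "norm \<dots> = (1 - s) * norm (1 / (z + of_real (k + s)) * (1 / (z + of_real (Suc k))))"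
        using s by (metis abs_of_nonneg diff_ge_0_iff_ge norm_mult norm_of_real of_real_1 of_real_diff)
      also have "\<dots> \<le> 1 * (C / ((norm z + (k + s)) * (norm z + Suc k)))"
        by (intro mult_mono inv_bound) (use s in auto)
      also have "\<dots> \<le> C / ((norm z + k) * (norm z + Suc k))"
        using s \<open>C > 0\<close> \<open>norm z > 0\<close>
        by (auto intro!: divide_left_mono mult_right_mono mult_pos_pos add_pos_nonneg)
      finally show "norm (1 / (z + of_nat k + \<xi>) - 1 / (z + of_nat (Suc k)))
          \<le> C / ((norm z + k) * (norm z + Suc k))" .
    qed auto
    moreover have "h 1 - h 0 = u k"
      by (simp add: h_def u_def add_ac)
    moreover have "1 / (norm z + k) - 1 / (norm z + Suc k) = 1 / ((norm z + k) * (norm z + Suc k))"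
    proof -
      have "norm z + k > 0" "norm z + Suc k > 0" using \<open>norm z > 0\<close> by (auto intro: add_pos_nonneg)
      then show ?thesis by (simp add: field_simps)
    qed
    ultimately show ?thesis by simp
  qed
  have partial_bound: "norm (\<Sum>k<m. u k) \<le> 2 / (norm z + Re z)" for m
  proof -
    have "norm (\<Sum>k<m. u k) \<le> (\<Sum>k<m. C * (1 / (norm z + k) - 1 / (norm z + Suc k)))"
      by (rule sum_norm_le) (rule u_bound)
    also have "\<dots> = C * (1 / norm z - 1 / (norm z + m))"
      unfolding sum_distrib_left[symmetric]
      using sum_lessThan_telescope'[of "\<lambda>k. 1 / (norm z + real k)" m] by simp
    also have "\<dots> \<le> C * (1 / norm z)"
      using \<open>C > 0\<close> \<open>norm z > 0\<close> by (intro mult_left_mono) auto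
    also have "\<dots> = 2 / (norm z + Re z)"
      using \<open>norm z > 0\<close> by (simp add: C_def)
    finally show ?thesis .
  qed
  have partial_eq: "(\<Sum>k<m. u k) =
      of_real (ln m) - (\<Sum>k<m. inverse (z + 1 + of_nat k)) - Ln z + Ln ((z + of_nat m) / of_nat m)"
    if "m > 0" for m
  proof -
    have "(\<Sum>k<m. u k) = Ln (z + of_nat m) - Ln z - (\<Sum>k<m. 1 / (z + of_nat (Suc k)))"
    proof -
      have "(\<Sum>k<m. u k) = (\<Sum>k<m. Ln (z + of_nat (Suc k)) - Ln (z + of_nat k)) - (\<Sum>k<m. 1 / (z + of_nat (Suc k)))"
        by (simp only: u_def sum_subtractf)
      then show ?thesis
        using sum_lessThan_telescope[of "\<lambda>k. Ln (z + of_nat k)" m] by simp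
    qed
    moreover have "z + of_nat m \<noteq> 0"
      using shift[of m] by auto
    then have "Ln ((z + of_nat m) / of_nat m) = Ln (z + of_nat m) - of_real (ln m)"
      using Ln_divide_of_real[of "real m" "z + of_nat m"] \<open>z + of_nat m \<noteq> 0\<close> that by simp
    ultimately show ?thesis
      by (simp add: inverse_eq_divide add_ac)
  qed
  have "(\<lambda>m. Ln ((z + of_nat m) / of_nat m)) \<longlonglongrightarrow> Ln 1"
  proof (rule tendsto_Ln)
    have "(\<lambda>m. z / of_nat m + 1) \<longlonglongrightarrow> 0 + 1"
      by (intro tendsto_intros lim_const_over_n)
    moreover have "eventually (\<lambda>m. z / of_nat m + 1 = (z + of_nat m) / of_nat m) sequentially"
      using eventually_gt_at_top[of 0] by eventually_elim (simp add: add_divide_distrib)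
    ultimately show "(\<lambda>m. (z + of_nat m) / of_nat m) \<longlonglongrightarrow> 1"
      by (simp add: tendsto_cong)
  qed auto
  moreover have "z + 1 \<noteq> 0"
    using shift[of 1] by auto
  ultimately have "(\<lambda>m. of_real (ln m) - (\<Sum>k<m. inverse (z + 1 + of_nat k)) - Ln z
      + Ln ((z + of_nat m) / of_nat m)) \<longlonglongrightarrow> Digamma (z + 1) - Ln z + Ln 1"
    by (intro tendsto_add tendsto_diff tendsto_const Digamma_LIMSEQ)
  moreover have "eventually (\<lambda>m. (\<Sum>k<m. u k) = of_real (ln m) - (\<Sum>k<m. inverse (z + 1 + of_nat k))
      - Ln z + Ln ((z + of_nat m) / of_nat m)) sequentially"
    using eventually_gt_at_top[of 0] by eventually_elim (rule partial_eq)
  ultimately have "(\<lambda>m. \<Sum>k<m. u k) \<longlonglongrightarrow> Digamma (z + 1) - Ln z"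
    by (simp add: tendsto_cong)
  then show ?thesis
    by (rule tendsto_upperbound[OF tendsto_norm]) (auto simp: partial_bound)
qed

section \<open>The telescoping dyadic series\<close>

lemma Nielsen_beta_odd_argument:
  "Nielsen_beta (2 * z + 1) = 1 / 2 * (Digamma (z + 1) - Digamma (z + 1 / 2))"
proof -
  have "(2 * z + 1) / 2 + 1 / 2 = z + 1" "(2 * z + 1) / 2 = z + 1 / 2"
    by (simp_all add: field_simps)
  then show ?thesis
    unfolding Nielsen_beta_def by (simp only: right_diff_distrib)
qed

text \<open>
  In the duplication formula shifted to \<open>\<Psi>(2z + 1)\<close>, the value \<open>\<Psi>(z + 1/2)\<close> is eliminated in favour
  of \<open>\<beta>(2z + 1)\<close>; the constant \<open>ln 2\<close> is exactly the difference of the two logarithms.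
\<close>

lemma Nielsen_beta_odd_telescopes:
  assumes z: "z \<notin> \<real>\<^sub>\<le>\<^sub>0"
  shows "Nielsen_beta (2 * z + 1) = (Digamma (z + 1) - Ln z) - (Digamma (2 * z + 1) - Ln (2 * z))"
proof -
  have nz: "z \<noteq> 0" "z \<noteq> - 1 / 2" using z by auto
  have Digamma_step: "Digamma (2 * z + 1) = Digamma (2 * z) + 1 / z / 2" "Digamma (z + 1) = Digamma z + 1 / z"
    using nz by (simp_all add: Digamma_plus1)
  have Ln_double: "Ln (2 * z) = of_real (ln 2) + Ln z"
    using Ln_times_of_real[of 2 z] Ln_of_real[of 2] nz by simp
  have "1 / 2 * (p + i - q) = (p + i - l) - (1 / 2 * p + 1 / 2 * q + d + i / 2 - (d + l))"
    for p q i d l :: complex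
    by (simp add: field_simps)
  then show ?thesis
    unfolding Nielsen_beta_odd_argument Digamma_step Ln_double Digamma_duplication[OF nz] .
qed

lemma power2_mult_not_nonpos_Real:
  fixes x :: complex
  assumes "x \<notin> \<real>\<^sub>\<le>\<^sub>0"
  shows "2 ^ k * x \<notin> \<real>\<^sub>\<le>\<^sub>0"
proof -
  have "2 ^ k * Re x \<le> 0 \<longleftrightarrow> Re x \<le> 0"
    using mult_le_cancel_left_pos[of "2 ^ k" "Re x" 0] by simp
  with assms show ?thesis
    by (simp add: complex_nonpos_Reals_iff)
qed

lemma Nielsen_beta_dyadic_sums:
  assumes x: "x \<notin> \<real>\<^sub>\<le>\<^sub>0"
  shows "(\<lambda>k. Nielsen_beta (2 ^ Suc k * x + 1)) sums (Digamma (x + 1) - Ln x)"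
proof -
  define v where "v k = Digamma (2 ^ k * x + 1) - Ln (2 ^ k * x)" for k :: nat
  have notin: "2 ^ k * x \<notin> \<real>\<^sub>\<le>\<^sub>0" for k :: nat
    by (rule power2_mult_not_nonpos_Real[OF x])
  have "v \<longlonglongrightarrow> 0"
  proof (rule Lim_null_comparison)
    show "eventually (\<lambda>k. norm (v k) \<le> 2 / (norm x + Re x) * (1 / 2) ^ k) sequentially"
    proof (intro always_eventually allI)
      fix k
      have "norm (2 ^ k * x) + Re (2 ^ k * x) = 2 ^ k * (norm x + Re x)"
        by (simp add: norm_mult norm_power distrib_left)
      with norm_Digamma_minus_Ln_le[OF notin[of k]]
      show "norm (v k) \<le> 2 / (norm x + Re x) * (1 / 2) ^ k"
        by (simp add: v_def power_one_over field_simps)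
    qed
    show "(\<lambda>k. 2 / (norm x + Re x) * (1 / 2) ^ k) \<longlonglongrightarrow> 0"
      by real_asymp
  qed
  from telescope_sums'[OF this] have "(\<lambda>k. v k - v (Suc k)) sums (Digamma (x + 1) - Ln x)"
    by (simp add: v_def)
  moreover have "Nielsen_beta (2 ^ Suc k * x + 1) = v k - v (Suc k)" for k
    using Nielsen_beta_odd_telescopes[OF notin[of k]] by (simp add: v_def mult.assoc)
  ultimately show ?thesis
    by (simp only:)
qed

theorem proposition20:
  shows
    "(\<forall>x::complex. x \<notin> \<real>\<^sub>\<le>\<^sub>0 \<longrightarrow>
        summable (\<lambda>k. Lerch_Phi1 (-1) (2 ^ Suc k * x + 1)) \<and>
        Digamma (x + 1) = Ln x + (\<Sum>k. Lerch_Phi1 (-1) (2 ^ Suc k * x + 1)) \<and>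
        (\<forall>k. summable (\<lambda>j. fact j / (2 ^ Suc j * pochhammer (2 ^ Suc k * x + 1) (Suc j)))) \<and>
        summable (\<lambda>k. \<Sum>j. fact j / (2 ^ Suc j * pochhammer (2 ^ Suc k * x + 1) (Suc j))) \<and>
        Digamma (x + 1) = Ln x +
          (\<Sum>k. \<Sum>j. fact j / (2 ^ Suc j * pochhammer (2 ^ Suc k * x + 1) (Suc j))))
     \<and>
     (\<forall>x::complex. x \<notin> \<real>\<^sub>\<le>\<^sub>0 \<longrightarrow>
        summable (\<lambda>n. Gamma (of_nat (Suc n)) / (2 ^ Suc n * pochhammer x (Suc n))) \<and>
        1 / 2 * Digamma (x / 2 + 1 / 2) - 1 / 2 * Digamma (x / 2) =
          (\<Sum>n. Gamma (of_nat (Suc n)) / (2 ^ Suc n * pochhammer x (Suc n))))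
     \<and>
     (\<forall>x::complex. Re x > 0 \<longrightarrow>
        ((\<lambda>t::real. of_real t powr (x - 1) / (of_real t + 1)) has_integral
          (1 / 2 * Digamma (x / 2 + 1 / 2) - 1 / 2 * Digamma (x / 2))) {0..1})
     \<and>
     (\<forall>x::complex. x \<notin> \<real>\<^sub>\<le>\<^sub>0 \<longrightarrow>
        summable (\<lambda>k. Digamma (2 ^ k * x + 1) - Digamma (2 ^ k * x + 1 / 2)) \<and>
        Digamma (x + 1) = Ln x +
          1 / 2 * (\<Sum>k. Digamma (2 ^ k * x + 1) - Digamma (2 ^ k * x + 1 / 2)))"
proof (intro conjI allI impI)
  fix x :: complex
  assume x: "x \<notin> \<real>\<^sub>\<le>\<^sub>0"
  have notin: "2 ^ Suc k * x + 1 \<notin> \<int>\<^sub>\<le>\<^sub>0" for k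
  proof -
    have "2 ^ Suc k * x + 1 \<notin> \<real>\<^sub>\<le>\<^sub>0"
      using power2_mult_not_nonpos_Real[OF x, of "Suc k"]
      by (auto simp only: complex_nonpos_Reals_iff plus_complex.sel one_complex.sel)
    then show ?thesis
      using nonpos_Ints_subset_nonpos_Reals by blast
  qed
  have x': "x \<notin> \<int>\<^sub>\<le>\<^sub>0"
    using x nonpos_Ints_subset_nonpos_Reals by blast
  note dyadic = Nielsen_beta_dyadic_sums[OF x]
  have Lerch: "Lerch_Phi1 (-1) (2 ^ Suc k * x + 1) = Nielsen_beta (2 ^ Suc k * x + 1)" for k
    by (rule Lerch_Phi1_minus_1[OF notin])
  show "summable (\<lambda>k. Lerch_Phi1 (-1) (2 ^ Suc k * x + 1))"
    "Digamma (x + 1) = Ln x + (\<Sum>k. Lerch_Phi1 (-1) (2 ^ Suc k * x + 1))"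
    unfolding Lerch using dyadic by (simp_all add: sums_iff)
  have series: "(\<lambda>j. fact j / (2 ^ Suc j * pochhammer (2 ^ Suc k * x + 1) (Suc j)))
      sums Nielsen_beta (2 ^ Suc k * x + 1)" for k
    using Nielsen_beta_series[OF notin[of k]] unfolding inverse_factorial_term_def[abs_def] .
  show "summable (\<lambda>j. fact j / (2 ^ Suc j * pochhammer (2 ^ Suc k * x + 1) (Suc j)) :: complex)" for k
    using series by (rule sums_summable)
  show "summable (\<lambda>k. \<Sum>j. fact j / (2 ^ Suc j * pochhammer (2 ^ Suc k * x + 1) (Suc j)))"
    "Digamma (x + 1) = Ln x +
          (\<Sum>k. \<Sum>j. fact j / (2 ^ Suc j * pochhammer (2 ^ Suc k * x + 1) (Suc j)))"
    unfolding sums_unique[OF series, symmetric] using dyadic by (simp_all add: sums_iff)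
  have Gamma_fact: "Gamma (of_nat (Suc n)) = (fact n :: complex)" for n
    using Gamma_fact[of n] by simp
  have beta_series: "(\<lambda>n. Gamma (of_nat (Suc n)) / (2 ^ Suc n * pochhammer x (Suc n))) sums Nielsen_beta x"
    using Nielsen_beta_series[OF x'] unfolding inverse_factorial_term_def[abs_def] Gamma_fact .
  show "summable (\<lambda>n. Gamma (of_nat (Suc n)) / (2 ^ Suc n * pochhammer x (Suc n)))"
    "1 / 2 * Digamma (x / 2 + 1 / 2) - 1 / 2 * Digamma (x / 2) =
          (\<Sum>n. Gamma (of_nat (Suc n)) / (2 ^ Suc n * pochhammer x (Suc n)))"
    using beta_series unfolding Nielsen_beta_def sums_iff by simp_all
  have "Nielsen_beta (2 ^ Suc k * x + 1) =
      1 / 2 * (Digamma (2 ^ k * x + 1) - Digamma (2 ^ k * x + 1 / 2))" for k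
    using Nielsen_beta_odd_argument[of "2 ^ k * x"] by (simp add: mult_ac)
  with dyadic have half: "(\<lambda>k. 1 / 2 * (Digamma (2 ^ k * x + 1) - Digamma (2 ^ k * x + 1 / 2)))
      sums (Digamma (x + 1) - Ln x)"
    by (simp only:)
  have "2 * (1 / 2 * a) = a" for a :: complex
    by simp
  with sums_mult[OF half, of 2]
  have "(\<lambda>k. Digamma (2 ^ k * x + 1) - Digamma (2 ^ k * x + 1 / 2)) sums (2 * (Digamma (x + 1) - Ln x))"
    by (simp only:)
  then show "summable (\<lambda>k. Digamma (2 ^ k * x + 1) - Digamma (2 ^ k * x + 1 / 2))"
    "Digamma (x + 1) = Ln x +
          1 / 2 * (\<Sum>k. Digamma (2 ^ k * x + 1) - Digamma (2 ^ k * x + 1 / 2))"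
    by (simp_all add: sums_iff diff_divide_distrib)
next
  fix x :: complex
  assume "Re x > 0"
  then show "((\<lambda>t::real. of_real t powr (x - 1) / (of_real t + 1)) has_integral
          (1 / 2 * Digamma (x / 2 + 1 / 2) - 1 / 2 * Digamma (x / 2))) {0..1}"
    using Nielsen_beta_integral_powr unfolding Nielsen_beta_def by blast
qed

end
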